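(* Let $d$ be a positive integer and set $k=2^{2d+3}$. If $\mathbf{G}=(V,E)$ is a finite graph of diameter at most $d$ and (vertex) connectivity at least $k$, then the pebbling number of $\mathbf{G}$ is $|V|$, i.e. $f(\mathbf{G})=|V|$.
   Context: For a finite graph $\mathbf{G}=(V,E)$, a pebbling is a function $\phi:V\to\mathbb{N}_0$ (number of pebbles on each vertex); its size is $\sum_{x\in V}\phi(x)$. A pebbling move takes a vertex $x$ with $\phi(x)\ge 2$, removes two pebbles from $x$ and adds one pebble to a vertex $y$ adjacent to $x$. A descendant of $\phi$ is any pebbling obtained from $\phi$ by a finite sequence of pebbling moves (including zero moves). $\phi$ has the potential to pebble $x$ if $\phi$ or one of its descendants assigns a positive number of pebbles to $x$. The pebbling number $f(\mathbf{G})$ is the least $p$ such that for every pebbling $\phi$ of size $p$ and every vertex $x\in V$, $\phi$ has the potential to pebble $x$. A graph is called Class $0$ if $f(\mathbf{G})=|V|$. *)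

theory Defs
  imports "Graph_Theory.Graph_Theory"
begin

text \<open>
  Distance is \<^const>\<open>wf_digraph.\<mu>\<close> with unit arc weights, so it counts the arcs of a shortest
  walk and is \<open>\<infinity>\<close> if there is none.
\<close>

definition diameter :: "('a, 'b) pre_digraph \<Rightarrow> ereal" where
  "diameter G = (SUP u \<in> verts G. SUP v \<in> verts G. wf_digraph.\<mu> G (\<lambda>_. 1) u v)"

text \<open>
  The least number of vertices whose removal leaves a disconnected graph or at most one vertex.
  The second alternative gives the complete graph on \<open>n \<ge> 1\<close> vertices connectivity \<open>n - 1\<close>.
\<close>

definition vertex_connectivity :: "('a, 'b) pre_digraph \<Rightarrow> nat" where
  "vertex_connectivity G =
    (LEAST n. \<exists>X \<subseteq> verts G. card X = n \<and>
      (\<not> Digraph_Component.connected (G \<restriction> (verts G - X)) \<or> card (verts G - X) \<le> 1))"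

text \<open>
  Pebblings are total functions on the type of vertices. Their values outside \<^term>\<open>verts G\<close> are
  not counted by the size and are neither used nor changed by a move in a well-formed graph.
\<close>

type_synonym 'a pebbling = "'a \<Rightarrow> nat"

definition pebbling_size :: "('a, 'b) pre_digraph \<Rightarrow> 'a pebbling \<Rightarrow> nat" where
  "pebbling_size G \<phi> = (\<Sum>x \<in> verts G. \<phi> x)"

text \<open>The update is the intended one only for \<open>x \<noteq> y\<close>, which holds in loop-free graphs.\<close>

inductive pebbling_move :: "('a, 'b) pre_digraph \<Rightarrow> 'a pebbling \<Rightarrow> 'a pebbling \<Rightarrow> bool"
  for G :: "('a, 'b) pre_digraph" where
  "x \<rightarrow>\<^bsub>G\<^esub> y \<Longrightarrow> 2 \<le> \<phi> x \<Longrightarrow> pebbling_move G \<phi> (\<phi>(x := \<phi> x - 2, y := \<phi> y + 1))"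

definition descendant :: "('a, 'b) pre_digraph \<Rightarrow> 'a pebbling \<Rightarrow> 'a pebbling \<Rightarrow> bool" where
  "descendant G \<phi> \<psi> \<longleftrightarrow> (pebbling_move G)\<^sup>*\<^sup>* \<phi> \<psi>"

definition potential_to_pebble :: "('a, 'b) pre_digraph \<Rightarrow> 'a pebbling \<Rightarrow> 'a \<Rightarrow> bool" where
  "potential_to_pebble G \<phi> x \<longleftrightarrow> (\<exists>\<psi>. descendant G \<phi> \<psi> \<and> 0 < \<psi> x)"

definition pebbling_number :: "('a, 'b) pre_digraph \<Rightarrow> nat" where
  "pebbling_number G =
    (LEAST p. \<forall>\<phi>. pebbling_size G \<phi> = p \<longrightarrow> (\<forall>x \<in> verts G. potential_to_pebble G \<phi> x))"

end

theory Submission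
  imports Defs "HOL-Library.Transitive_Closure_Table"
begin

text \<open>
  Suppose that a pebbling \<open>\<phi>\<close> of size \<open>|V|\<close> cannot reach \<open>r\<close>, and let \<open>t = 2^d\<close>. Then no vertex can ever
  collect \<open>t\<close> pebbles. Let \<open>P\<close> be the occupied vertices, \<open>U\<close> the empty ones, and \<open>B\<close> the vertices with at
  least two pebbles. A pebble can travel from \<open>x \<in> B\<close> along any path in \<open>P\<close>, and \<open>x\<close> can send out
  \<open>c x = \<phi> x div 2\<close> pebbles on disjoint paths, where \<open>|U| \<le> 2 c(B)\<close> since \<open>\<phi>\<close> has size \<open>|V|\<close>.
  By max-flow min-cut, every \<open>x \<in> B\<close> lies in a set \<open>A x \<subseteq> P\<close> that contains no other vertex of \<open>B\<close> and whose
  boundary in \<open>P\<close> has \<open>c\<close>-weight less than \<open>t\<close>. A greedy choice yields \<open>I \<subseteq> B\<close> with \<open>c(B) \<le> 2 t |I|\<close> such that no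
  vertex of \<open>I\<close> is in the boundary of the set of another one, and for these vertices the sets of minimal size
  are pairwise disjoint by uncrossing. As \<open>A x\<close> together with its boundary misses \<open>r\<close>, connectivity
  gives it at least \<open>8 t^2 - t\<close> neighbours in \<open>U\<close>, so by double counting some \<open>u \<in> U\<close> is adjacent to at
  least \<open>t\<close> of the sets and collects a pebble from each.
\<close>

section \<open>Integral max-flow min-cut\<close>

text \<open>The flow is 1 on the arcs of the path and -1 on their reverses. The last conjunct serves
  the induction: the new first vertex is not on the rest of the path, so \<open>q\<close> vanishes
  there and the bound survives the new arc.\<close>

lemma unit_flow_along_path:
  assumes "rtrancl_path r x xs y" "distinct (x # xs)" "finite V" "set (x # xs) \<subseteq> V"
  shows "\<exists>q :: 'a \<Rightarrow> 'a \<Rightarrow> int. (\<forall>a b. q a b = - q b a) \<and> (\<forall>a b. q a b \<le> of_bool (r a b)) \<and>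
    (\<forall>a. (\<Sum>b\<in>V. q a b) = of_bool (a = x) - of_bool (a = y)) \<and>
    (\<forall>a b. q a b \<noteq> 0 \<longrightarrow> a \<in> set (x # xs))"
  using assms
proof (induction rule: rtrancl_path.induct)
  case (base x)
  show ?case by (rule exI[of _ "\<lambda>_ _. 0"]) simp
next
  case (step x y ys z)
  have "distinct (y # ys)" "set (y # ys) \<subseteq> V" using step.prems by auto
  from step.IH[OF this(1) assms(3) this(2)]
  obtain q :: "'a \<Rightarrow> 'a \<Rightarrow> int" where q: "\<And>a b. q a b = - q b a"
    "\<And>a b. q a b \<le> of_bool (r a b)"
    "\<And>a. (\<Sum>b\<in>V. q a b) = of_bool (a = y) - of_bool (a = z)"
    "\<And>a b. q a b \<noteq> 0 \<Longrightarrow> a \<in> set (y # ys)"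
    by blast
  have ne: "x \<noteq> y" and V: "x \<in> V" "y \<in> V" using step.prems by auto
  have q0: "q x b = 0" "q b x = 0" for b
    using q(4)[of x b] q(1)[of b x] step.prems(1) by auto
  define p where "p a b = q a b + of_bool (a = x \<and> b = y) - of_bool (a = y \<and> b = x)" for a b
  have "p a b = - p b a" for a b
    using q(1)[of a b] by (simp add: p_def conj_commute)
  moreover have "p a b \<le> of_bool (r a b)" for a b
  proof (cases "a = x \<and> b = y")
    case True
    then show ?thesis using step.hyps(1) q0 ne by (simp add: p_def)
  next
    case False
    then have "p a b \<le> q a b" by (cases "a = x") (simp_all add: p_def)
    then show ?thesis using q(2)[of a b] by linarith
  qed
  moreover have "(\<Sum>b\<in>V. p a b) = of_bool (a = x) - of_bool (a = z)" for a
  proof -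
    have d: "(\<Sum>b\<in>V. of_bool (a = u \<and> b = v) :: int) = of_bool (a = u)" if "v \<in> V" for u v
    proof (cases "a = u")
      case True
      then show ?thesis using that assms(3) by (simp add: of_bool_def sum.delta)
    qed simp
    show ?thesis using q(3)[of a] d[OF V(1), of y] d[OF V(2), of x]
      by (simp add: p_def sum.distrib sum_subtractf)
  qed
  moreover have "a \<in> set (x # y # ys)" if "p a b \<noteq> 0" for a b
  proof (rule ccontr)
    assume "a \<notin> set (x # y # ys)"
    with q(4)[of a b] have "q a b = 0" "a \<noteq> x" "a \<noteq> y" by auto
    with that show False by (simp add: p_def)
  qed
  ultimately show ?case by blast
qed

definition is_flow :: "'n set \<Rightarrow> ('n \<Rightarrow> 'n \<Rightarrow> nat) \<Rightarrow> 'n \<Rightarrow> 'n \<Rightarrow> ('n \<Rightarrow> 'n \<Rightarrow> int) \<Rightarrow> bool" where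
  "is_flow V cap s t g \<longleftrightarrow> (\<forall>a b. g a b = - g b a) \<and> (\<forall>a b. g a b \<le> int (cap a b)) \<and>
    (\<forall>a \<in> V - {s, t}. (\<Sum>b\<in>V. g a b) = 0)"

text \<open>By integrality every residual arc has room for a full unit, so the unit flow along a
  simple residual path can be added.\<close>

lemma is_flow_augment:
  assumes fin: "finite V" and st: "s \<noteq> t" and g: "is_flow V cap s t g"
    and r: "(\<lambda>a b. a \<in> V \<and> b \<in> V \<and> g a b < int (cap a b))\<^sup>*\<^sup>* s t" and "s \<in> V"
  obtains h where "is_flow V cap s t h" "(\<Sum>b\<in>V. h b t) = (\<Sum>b\<in>V. g b t) + 1"
proof -
  let ?r = "\<lambda>a b. a \<in> V \<and> b \<in> V \<and> g a b < int (cap a b)"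
  from r obtain xs0 where "rtrancl_path ?r s xs0 t"
    by (auto simp: rtranclp_eq_rtrancl_path)
  then obtain xs where xs: "rtrancl_path ?r s xs t" "distinct (s # xs)"
    by (rule rtrancl_path_distinct)
  from xs(1) have "s \<in> V \<Longrightarrow> set (s # xs) \<subseteq> V"
    by (induction rule: rtrancl_path.induct) auto
  from unit_flow_along_path[OF xs fin this] \<open>s \<in> V\<close> obtain q :: "'a \<Rightarrow> 'a \<Rightarrow> int"
    where q: "\<And>a b. q a b = - q b a" "\<And>a b. q a b \<le> of_bool (?r a b)"
      "\<And>a. (\<Sum>b\<in>V. q a b) = of_bool (a = s) - of_bool (a = t)" by blast
  let ?h = "\<lambda>a b. g a b + q a b"
  have "is_flow V cap s t ?h"
    unfolding is_flow_def
  proof (intro conjI allI ballI)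
    fix a b
    have "g a b = - g b a" using g unfolding is_flow_def by blast
    with q(1)[of a b] show "?h a b = - ?h b a" by linarith
    have "g a b \<le> int (cap a b)" using g unfolding is_flow_def by blast
    with q(2)[of a b] show "?h a b \<le> int (cap a b)" by (cases "?r a b") simp_all
  next
    fix a assume "a \<in> V - {s, t}"
    moreover from this g have "(\<Sum>b\<in>V. g a b) = 0" unfolding is_flow_def by blast
    ultimately show "(\<Sum>b\<in>V. ?h a b) = 0" using q(3)[of a] by (simp add: sum.distrib)
  qed
  moreover have "(\<Sum>b\<in>V. q b t) = 1"
  proof -
    have "(\<Sum>b\<in>V. q b t) = (\<Sum>b\<in>V. - q t b)" by (intro sum.cong refl q(1))
    then show ?thesis using q(3)[of t] st by (simp add: sum_negf)
  qed
  ultimately show thesis using that by (simp add: sum.distrib)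
qed

lemma sum_skew_symmetric:
  fixes g :: "'a \<Rightarrow> 'a \<Rightarrow> int"
  assumes "\<And>a b. g a b = - g b a"
  shows "(\<Sum>a\<in>S. \<Sum>b\<in>S. g a b) = 0"
proof -
  have "(\<Sum>a\<in>S. \<Sum>b\<in>S. g a b) = (\<Sum>a\<in>S. \<Sum>b\<in>S. - g b a)"
    by (intro sum.cong refl) (rule assms)
  also have "\<dots> = - (\<Sum>a\<in>S. \<Sum>b\<in>S. g a b)"
    by (subst sum.swap) (simp add: sum_negf)
  finally show ?thesis by simp
qed

text \<open>Ford-Fulkerson: augment while the sink is reachable by residual arcs; once it is not,
  the reachable set is a saturated cut.\<close>

theorem max_flow_min_cut:
  assumes fin: "finite V" and st: "s \<in> V" "t \<in> V" "s \<noteq> t"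
  obtains g R where "is_flow V cap s t g" "R \<subseteq> V" "s \<in> R" "t \<notin> R"
    "(\<Sum>b\<in>V. g b t) = (\<Sum>a\<in>R. \<Sum>b\<in>V - R. int (cap a b))"
proof -
  let ?P = "\<lambda>g R. is_flow V cap s t g \<and> R \<subseteq> V \<and> s \<in> R \<and> t \<notin> R \<and>
    (\<Sum>b\<in>V. g b t) = (\<Sum>a\<in>R. \<Sum>b\<in>V - R. int (cap a b))"
  have main: "\<exists>g R. ?P g R" if "is_flow V cap s t g" for g
    using that
  \<comment> \<open>The flow value is bounded by the total capacity into \<open>t\<close>, and each
    augmentation narrows the gap by one.\<close>
  proof (induction "nat ((\<Sum>b\<in>V. int (cap b t)) - (\<Sum>b\<in>V. g b t))" arbitrary: g rule: less_induct)
    case less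
    let ?r = "\<lambda>a b. a \<in> V \<and> b \<in> V \<and> g a b < int (cap a b)"
    have skew: "g a b = - g b a" and le: "g a b \<le> int (cap a b)" for a b
      using less.prems unfolding is_flow_def by blast+
    show ?case
    proof (cases "?r\<^sup>*\<^sup>* s t")
      case True
      from is_flow_augment[OF fin st(3) less.prems True st(1)]
      obtain h where h: "is_flow V cap s t h" "(\<Sum>b\<in>V. h b t) = (\<Sum>b\<in>V. g b t) + 1"
        by blast
      have "(\<Sum>b\<in>V. h b t) \<le> (\<Sum>b\<in>V. int (cap b t))"
        using h(1) unfolding is_flow_def by (intro sum_mono) blast
      with less.hyps[OF _ h(1)] h(2) show ?thesis by simp
    next
      case False
      define R where "R = {a \<in> V. ?r\<^sup>*\<^sup>* s a}"
      have R: "R \<subseteq> V" "s \<in> R" "t \<notin> R" using False st by (auto simp: R_def)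
      have sat: "g a b = int (cap a b)" if "a \<in> R" "b \<in> V - R" for a b
      proof (rule ccontr)
        assume "g a b \<noteq> int (cap a b)"
        with le[of a b] that have "?r a b" "?r\<^sup>*\<^sup>* s a" by (auto simp: R_def)
        then have "?r\<^sup>*\<^sup>* s b" by (rule_tac rtranclp.rtrancl_into_rtrancl)
        with that show False by (simp add: R_def)
      qed
      have fR: "finite R" "finite (V - R)" using fin R(1) finite_subset by auto
      have into: "(\<Sum>b\<in>V. g b a) = - (\<Sum>b\<in>V. g a b)" for a
        unfolding sum_negf[symmetric] by (intro sum.cong refl skew)
      \<comment> \<open>Only \<open>t\<close> can have nonzero net inflow within
        \<open>V - R\<close>, so the flow value is the net inflow of \<open>V - R\<close>; flow
        inside that set cancels by skew symmetry.\<close>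
      have "(\<Sum>b\<in>V. g b t) = (\<Sum>a\<in>V - R. \<Sum>b\<in>V. g b a)"
      proof -
        have cons: "(\<Sum>b\<in>V. g b a) = 0" if "a \<in> V - {s, t}" for a
        proof -
          have "(\<Sum>b\<in>V. g a b) = 0" using less.prems that unfolding is_flow_def by blast
          then show ?thesis by (simp add: into)
        qed
        have "(\<Sum>a\<in>V - R. \<Sum>b\<in>V. g b a) = (\<Sum>a\<in>{t}. \<Sum>b\<in>V. g b a)"
          by (rule sum.mono_neutral_right)
            (use fR R st cons in auto)
        then show ?thesis by simp
      qed
      also have "\<dots> = (\<Sum>a\<in>V - R. (\<Sum>b\<in>R. g b a) + (\<Sum>b\<in>V - R. g b a))"
        using sum.subset_diff[OF R(1) fin] by (intro sum.cong) (auto simp: add.commute)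
      also have "\<dots> = (\<Sum>a\<in>V - R. \<Sum>b\<in>R. g b a)"
      proof -
        have "(\<Sum>a\<in>V - R. \<Sum>b\<in>V - R. g b a) = 0"
          by (subst sum.swap, rule sum_skew_symmetric) (rule skew)
        then show ?thesis by (simp add: sum.distrib)
      qed
      also have "\<dots> = (\<Sum>a\<in>R. \<Sum>b\<in>V - R. g a b)" by (rule sum.swap)
      also have "\<dots> = (\<Sum>a\<in>R. \<Sum>b\<in>V - R. int (cap a b))"
        by (intro sum.cong refl) (rule sat)
      finally show ?thesis using less.prems R by blast
    qed
  qed
  have "is_flow V cap s t (\<lambda>_ _. 0)" by (simp add: is_flow_def)
  from main[OF this] show thesis using that by blast
qed

section \<open>Descendants and move counts\<close>

lemma descendant_trans: "descendant G \<phi> \<psi> \<Longrightarrow> descendant G \<psi> \<chi> \<Longrightarrow> descendant G \<phi> \<chi>"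
  unfolding descendant_def by (rule rtranclp_trans)

lemma descendant_refl: "descendant G \<phi> \<phi>"
  by (simp add: descendant_def)

lemma descendant_move:
  "x \<rightarrow>\<^bsub>G\<^esub> y \<Longrightarrow> 2 \<le> \<phi> x \<Longrightarrow> descendant G \<phi> (\<phi>(x := \<phi> x - 2, y := \<phi> y + 1))"
  unfolding descendant_def by (intro r_into_rtranclp pebbling_move.intros)

lemma potential_to_pebble_descendant:
  "descendant G \<phi> \<psi> \<Longrightarrow> potential_to_pebble G \<psi> x \<Longrightarrow> potential_to_pebble G \<phi> x"
  unfolding potential_to_pebble_def using descendant_trans by blast

text \<open>
  The order of the \<open>m v w\<close> moves need not be given. When none of the remaining ones can be executed,
  every vertex has at least as many incoming as outgoing moves left, hence equally many, and what
  remains can be dropped.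
\<close>

lemma (in graph) pebbling_by_move_counts:
  fixes m :: "'a \<Rightarrow> 'a \<Rightarrow> nat"
  assumes "\<And>v w. 0 < m v w \<Longrightarrow> v \<rightarrow> w"
    and "\<And>v. v \<in> verts G \<Longrightarrow> 2 * (\<Sum>w\<in>verts G. m v w) \<le> \<phi> v + (\<Sum>w\<in>verts G. m w v)"
    and x: "x \<in> verts G"
  shows "\<exists>\<psi>. descendant G \<phi> \<psi> \<and>
    \<phi> x + (\<Sum>w\<in>verts G. m w x) \<le> \<psi> x + 2 * (\<Sum>w\<in>verts G. m x w)"
  using assms(1,2)
proof (induction "\<Sum>v\<in>verts G. \<Sum>w\<in>verts G. m v w" arbitrary: \<phi> m rule: less_induct)
  case less
  let ?V = "verts G"
  let ?out = "\<lambda>m v. \<Sum>w\<in>?V. m v w :: nat" and ?in = "\<lambda>m v. \<Sum>w\<in>?V. m w v :: nat"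
  show ?case
  proof (cases "\<exists>v\<in>?V. 0 < ?out m v \<and> 2 \<le> \<phi> v")
    case True
    then obtain v where v: "v \<in> ?V" "0 < ?out m v" "2 \<le> \<phi> v" by blast
    then have "\<exists>w\<in>?V. m v w \<noteq> 0" by (metis less_irrefl sum.neutral)
    then obtain w where w: "w \<in> ?V" "0 < m v w" by blast
    from less.prems(1)[OF w(2)] have vw: "v \<rightarrow> w" .
    then have ne: "v \<noteq> w" using adj_not_same by blast
    define m' where "m' a b = m a b - of_bool (a = v \<and> b = w)" for a b
    have m: "m a b = m' a b + of_bool (a = v \<and> b = w)" for a b
      using w(2) by (simp add: m'_def)
    have out: "?out m a = ?out m' a + of_bool (a = v)" for a
    proof -
      have "(\<Sum>b\<in>?V. of_bool (a = v \<and> b = w)) = (of_bool (a = v) :: nat)"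
        by (cases "a = v") (use w(1) in \<open>simp_all add: of_bool_def sum.delta\<close>)
      then show ?thesis by (simp add: m sum.distrib)
    qed
    have inn: "?in m a = ?in m' a + of_bool (a = w)" for a
    proof -
      have "(\<Sum>b\<in>?V. of_bool (b = v \<and> a = w)) = (of_bool (a = w) :: nat)"
        by (cases "a = w") (use v(1) in \<open>simp_all add: of_bool_def sum.delta\<close>)
      then show ?thesis by (simp add: m sum.distrib)
    qed
    define \<phi>' where "\<phi>' = \<phi>(v := \<phi> v - 2, w := \<phi> w + 1)"
    have \<phi>': "\<phi>' a + 2 * of_bool (a = v) = \<phi> a + of_bool (a = w)" for a
      using ne v(3) by (cases "a = v") (simp_all add: \<phi>'_def)
    have "(\<Sum>a\<in>?V. ?out m' a) < (\<Sum>a\<in>?V. ?out m a)"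
      by (rule sum_strict_mono_ex1) (use v(1) out in auto)
    then have "\<exists>\<psi>. descendant G \<phi>' \<psi> \<and> \<phi>' x + ?in m' x \<le> \<psi> x + 2 * ?out m' x"
    proof (rule less.hyps)
      show "a \<rightarrow> b" if "0 < m' a b" for a b
        using that less.prems(1)[of a b] by (simp add: m'_def)
      show "2 * ?out m' a \<le> \<phi>' a + ?in m' a" if "a \<in> ?V" for a
        using less.prems(2)[OF that] out[of a] inn[of a] \<phi>'[of a] by linarith
    qed
    then obtain \<psi> where \<psi>: "descendant G \<phi>' \<psi>" "\<phi>' x + ?in m' x \<le> \<psi> x + 2 * ?out m' x"
      by blast
    have "descendant G \<phi> \<psi>"
      using descendant_move[where \<phi>=\<phi>, OF vw v(3)] \<psi>(1) descendant_trans unfolding \<phi>'_def by blast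
    moreover have "\<phi> x + ?in m x \<le> \<psi> x + 2 * ?out m x"
      using \<psi>(2) out[of x] inn[of x] \<phi>'[of x] by linarith
    ultimately show ?thesis by blast
  next
    case False
    \<comment> \<open>If moves out of \<open>v\<close> remain, then \<open>\<phi> v \<le> 1\<close>,
      so twice the out-count exceeds the in-count by at most one; the out-count being positive, it
      is at most the in-count.\<close>
    have le: "?out m v \<le> ?in m v" if "v \<in> ?V" for v
      using less.prems(2)[OF that] False that by (cases "?out m v = 0") force+
    \<comment> \<open>Out-counts and in-counts have the same total, so none of the inequalities
      \<open>le\<close> is strict.\<close>
    have "?in m x \<le> 2 * ?out m x"
    proof (rule ccontr)
      assume "\<not> ?thesis"
      then have "?out m x < ?in m x" by linarith
      then have "(\<Sum>v\<in>?V. ?out m v) < (\<Sum>v\<in>?V. ?in m v)"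
        using le x by (intro sum_strict_mono_ex1[OF finite_verts, where f = "?out m"]) blast+
      also have "\<dots> = (\<Sum>v\<in>?V. ?out m v)" by (rule sum.swap)
      finally show False by simp
    qed
    then show ?thesis using descendant_refl[of G \<phi>] by (intro exI[of _ \<phi>]) simp
  qed
qed

section \<open>Pebbling within the diameter\<close>

text \<open>Each arc costs a factor of two. All moves over the first arc are made in one batch, by a
  single use of the move counts.\<close>

lemma (in graph) pebble_along_awalk:
  assumes "awalk u p v" "2 ^ length p \<le> \<phi> u"
  shows "potential_to_pebble G \<phi> v"
  using assms
proof (induction p arbitrary: u \<phi>)
  case Nil
  then have "0 < \<phi> v" by (auto simp: awalk_Nil_iff)
  then show ?case unfolding potential_to_pebble_def using descendant_refl by blast
next
  case (Cons e p)
  let ?w = "head G e"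
  have e: "e \<in> arcs G" "u = tail G e" "awalk ?w p v"
    using Cons.prems(1) by (auto simp: awalk_Cons_iff)
  then have uw: "u \<rightarrow> ?w" "u \<in> verts G" "?w \<in> verts G" by (auto simp: arcs_ends_def arc_to_ends_def)
  then have ne: "u \<noteq> ?w" using adj_not_same by blast
  define m :: "'a \<Rightarrow> 'a \<Rightarrow> nat" where "m a b = (if a = u \<and> b = ?w then 2 ^ length p else 0)" for a b
  have out: "(\<Sum>b\<in>verts G. m a b) = (if a = u then 2 ^ length p else 0)" for a
    using uw(3) by (simp add: m_def sum.delta)
  have inn: "(\<Sum>b\<in>verts G. m b a) = (if a = ?w then 2 ^ length p else 0)" for a
    using uw(2) by (simp add: m_def sum.delta)
  have "\<exists>\<psi>. descendant G \<phi> \<psi> \<and>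
    \<phi> ?w + (\<Sum>b\<in>verts G. m b ?w) \<le> \<psi> ?w + 2 * (\<Sum>b\<in>verts G. m ?w b)"
  proof (rule pebbling_by_move_counts)
    show "a \<rightarrow> b" if "0 < m a b" for a b using that uw(1) by (simp add: m_def split: if_splits)
    show "2 * (\<Sum>w\<in>verts G. m a w) \<le> \<phi> a + (\<Sum>w\<in>verts G. m w a)" for a
      using Cons.prems(2) by (simp add: out inn)
  qed (use uw in simp)
  then obtain \<psi> where "descendant G \<phi> \<psi>" "2 ^ length p \<le> \<psi> ?w"
    using ne by (auto simp: out inn)
  then show ?case by (rule potential_to_pebble_descendant[OF _ Cons.IH[OF e(3)]])
qed

text \<open>A finite distance is attained by a path, whose cost under unit weights is its number of
  arcs.\<close>

lemma (in graph) awalk_length_le_diameter: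
  assumes "diameter G \<le> ereal (real d)" "u \<in> verts G" "v \<in> verts G"
  obtains p where "awalk u p v" "length p \<le> d"
proof -
  have "\<mu> (\<lambda>_. 1) u v \<le> diameter G"
    unfolding diameter_def by (intro SUP_upper2[OF assms(2)] SUP_upper2[OF assms(3)] order_refl)
  then have le: "\<mu> (\<lambda>_. 1) u v \<le> ereal (real d)" using assms(1) by (rule order_trans)
  then have "u \<rightarrow>\<^sup>* v" by (subst \<mu>_reach_conv[symmetric, where f = "\<lambda>_. 1"]) auto
  from min_cost_awalk[OF this, of "\<lambda>_. 1"] obtain p
    where p: "apath u p v" "\<mu> (\<lambda>_. 1) u v = awalk_cost (\<lambda>_. 1) p" by auto
  have "awalk_cost (\<lambda>_. 1) p = real (length p)"
    by (simp add: awalk_cost_def sum_list_triv)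
  with p le that[of p] show thesis by (auto simp: apath_def)
qed

lemma (in graph) potential_to_pebble_if_collected:
  assumes "diameter G \<le> ereal (real d)" "u \<in> verts G" "v \<in> verts G"
    and "descendant G \<phi> \<psi>" "2 ^ d \<le> \<psi> u"
  shows "potential_to_pebble G \<phi> v"
proof -
  obtain p where p: "awalk u p v" "length p \<le> d"
    using awalk_length_le_diameter assms(1-3) by blast
  have "(2::nat) ^ length p \<le> 2 ^ d" using p(2) by (simp add: power_increasing)
  with pebble_along_awalk[OF p(1), of \<psi>] assms(4,5) show ?thesis
    using potential_to_pebble_descendant by force
qed

section \<open>Pebbles travelling through occupied vertices\<close>

text \<open>Every inner vertex has a pebble of its own, so the arriving one makes two, enough for
  the next move. The last conjunct allows disjoint paths to be used one after another.\<close>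

lemma pebble_along_occupied_path:
  assumes "rtrancl_path (\<lambda>a b. a \<rightarrow>\<^bsub>G\<^esub> b) x xs u" "distinct (x # xs)" "xs \<noteq> []" "2 \<le> \<phi> x"
    and "\<And>v. v \<in> set xs - {u} \<Longrightarrow> 1 \<le> \<phi> v"
  shows "\<exists>\<psi>. descendant G \<phi> \<psi> \<and> \<psi> u = \<phi> u + 1 \<and> (\<forall>v. v \<notin> set (x # xs) \<longrightarrow> \<psi> v = \<phi> v)"
  using assms
proof (induction arbitrary: \<phi> rule: rtrancl_path.induct)
  case (base x)
  then show ?case by simp
next
  case (step x y ys z)
  define \<phi>' where "\<phi>' = \<phi>(x := \<phi> x - 2, y := \<phi> y + 1)"
  have d: "descendant G \<phi> \<phi>'"
    unfolding \<phi>'_def using step.hyps(1) step.prems(3) by (intro descendant_move)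
  show ?case
  proof (cases "ys = []")
    case True
    with step.hyps(2) have "y = z" by (auto elim: rtrancl_path.cases)
    moreover have "\<phi>' y = \<phi> y + 1" "\<forall>v. v \<notin> set (x # y # ys) \<longrightarrow> \<phi>' v = \<phi> v"
      by (auto simp: \<phi>'_def)
    ultimately show ?thesis using d by blast
  next
    case False
    have z: "z \<in> set ys" using step.hyps(2) False by (induction rule: rtrancl_path.induct)
      (auto elim: rtrancl_path.cases)
    then have yz: "y \<noteq> z" "x \<noteq> z" using step.prems(1) by auto
    have "\<exists>\<psi>. descendant G \<phi>' \<psi> \<and> \<psi> z = \<phi>' z + 1 \<and> (\<forall>v. v \<notin> set (y # ys) \<longrightarrow> \<psi> v = \<phi>' v)"
    proof (rule step.IH)
      show "distinct (y # ys)" using step.prems(1) by simp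
      show "2 \<le> \<phi>' y" using step.prems(4)[of y] yz by (simp add: \<phi>'_def)
      show "1 \<le> \<phi>' v" if "v \<in> set ys - {z}" for v
        using step.prems(4)[of v] step.prems(1) that by (auto simp: \<phi>'_def)
    qed fact
    then obtain \<psi> where \<psi>: "descendant G \<phi>' \<psi>" "\<psi> z = \<phi>' z + 1"
      "\<And>v. v \<notin> set (y # ys) \<Longrightarrow> \<psi> v = \<phi>' v" by blast
    have "\<psi> v = \<phi> v" if "v \<notin> set (x # y # ys)" for v
      using \<psi>(3)[of v] that by (simp add: \<phi>'_def)
    then show ?thesis
      using descendant_trans[OF d \<psi>(1)] \<psi>(2) yz by (intro exI[of _ \<psi>]) (simp add: \<phi>'_def)
  qed
qed

text \<open>The territories send one pebble each, in turn. As they are disjoint and avoid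
  \<open>u\<close>, the earlier ones leave the next one intact.\<close>

lemma pebbles_collected_from_territories:
  assumes "finite J" "\<And>x. x \<in> J \<Longrightarrow> 2 \<le> \<phi> x" "\<And>x v. x \<in> J \<Longrightarrow> v \<in> T x \<Longrightarrow> 1 \<le> \<phi> v"
    and "\<And>x. x \<in> J \<Longrightarrow> x \<in> T x \<and> u \<notin> T x"
    and "\<And>x y. x \<in> J \<Longrightarrow> y \<in> J \<Longrightarrow> x \<noteq> y \<Longrightarrow> T x \<inter> T y = {}"
    and "\<And>x. x \<in> J \<Longrightarrow> \<exists>v. (\<lambda>a b. a \<rightarrow>\<^bsub>G\<^esub> b \<and> b \<in> T x)\<^sup>*\<^sup>* x v \<and> v \<rightarrow>\<^bsub>G\<^esub> u"
  shows "\<exists>\<psi>. descendant G \<phi> \<psi> \<and> \<psi> u = \<phi> u + card J \<and>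
    (\<forall>v. v \<notin> insert u (\<Union>x\<in>J. T x) \<longrightarrow> \<psi> v = \<phi> v)"
  using assms
proof (induction J rule: finite_induct)
  case empty
  then show ?case using descendant_refl by auto
next
  case (insert x J)
  have "\<exists>\<psi>. descendant G \<phi> \<psi> \<and> \<psi> u = \<phi> u + card J \<and>
    (\<forall>v. v \<notin> insert u (\<Union>x\<in>J. T x) \<longrightarrow> \<psi> v = \<phi> v)"
    by (rule insert.IH; rule insert.prems) simp_all
  then obtain \<psi> where \<psi>: "descendant G \<phi> \<psi>" "\<psi> u = \<phi> u + card J"
    "\<And>v. v \<notin> insert u (\<Union>x\<in>J. T x) \<Longrightarrow> \<psi> v = \<phi> v" by blast
  have xT: "x \<in> T x" "u \<notin> T x" using insert.prems(3)[of x] by auto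
  have same: "\<psi> v = \<phi> v" if "v \<in> T x" for v
  proof (rule \<psi>(3))
    have "T x \<inter> T y = {}" if "y \<in> J" for y
      using insert.prems(4)[of x y] insert.hyps(2) that by blast
    then show "v \<notin> insert u (\<Union>x\<in>J. T x)" using that xT by blast
  qed
  obtain v where v: "(\<lambda>a b. a \<rightarrow>\<^bsub>G\<^esub> b \<and> b \<in> T x)\<^sup>*\<^sup>* x v" "v \<rightarrow>\<^bsub>G\<^esub> u"
    using insert.prems(5)[of x] by blast
  \<comment> \<open>The walk inside \<open>T x\<close> is extended by the arc to \<open>u\<close>
    and then shortened to a simple path, on which only \<open>u\<close> may be empty.\<close>
  let ?r = "\<lambda>a b. a \<rightarrow>\<^bsub>G\<^esub> b \<and> b \<in> insert u (T x)"
  have "?r\<^sup>*\<^sup>* x v" using v(1) by (rule rtranclp_mono[THEN predicate2D, rotated]) auto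
  then have "?r\<^sup>*\<^sup>* x u" using v(2) by (auto intro: rtranclp.rtrancl_into_rtrancl)
  then obtain xs0 where "rtrancl_path ?r x xs0 u" by (auto simp: rtranclp_eq_rtrancl_path)
  then obtain xs where xs: "rtrancl_path ?r x xs u" "distinct (x # xs)"
    by (rule rtrancl_path_distinct)
  have sub: "set xs \<subseteq> S" if "rtrancl_path (\<lambda>a b. a \<rightarrow>\<^bsub>G\<^esub> b \<and> b \<in> S) x xs u" for x u S
    using that by (induction rule: rtrancl_path.induct) auto
  note sub = sub[OF xs(1)]
  have path: "rtrancl_path (\<lambda>a b. a \<rightarrow>\<^bsub>G\<^esub> b) x xs u"
    using xs(1) by (induction rule: rtrancl_path.induct) (auto intro: rtrancl_path.intros)
  have "xs \<noteq> []" using xs(1) xT by (auto elim: rtrancl_path.cases)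
  have "\<exists>\<chi>. descendant G \<psi> \<chi> \<and> \<chi> u = \<psi> u + 1 \<and> (\<forall>v. v \<notin> set (x # xs) \<longrightarrow> \<chi> v = \<psi> v)"
  proof (rule pebble_along_occupied_path[OF path xs(2) \<open>xs \<noteq> []\<close>])
    show "2 \<le> \<psi> x" using same xT insert.prems(1)[of x] by simp
    show "1 \<le> \<psi> v" if "v \<in> set xs - {u}" for v
      using that sub same[of v] insert.prems(2)[of x v] by auto
  qed
  then obtain \<chi> where \<chi>: "descendant G \<psi> \<chi>" "\<chi> u = \<psi> u + 1"
    "\<And>v. v \<notin> set (x # xs) \<Longrightarrow> \<chi> v = \<psi> v" by blast
  have "\<chi> v = \<phi> v" if "v \<notin> insert u (\<Union>x\<in>insert x J. T x)" for v
    using \<psi>(3)[of v] \<chi>(3)[of v] that sub xT by auto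
  then show ?case
    using descendant_trans[OF \<psi>(1) \<chi>(1)] \<chi>(2) \<psi>(2) insert.hyps by (intro exI[of _ \<chi>]) simp
qed

section \<open>Isolating sets from minimum cuts\<close>

lemma (in graph) adj_sym: "v \<rightarrow> w \<Longrightarrow> w \<rightarrow> v"
  using arcs_ends_symmetric[OF sym_arcs] .

text \<open>The outer vertex boundary in the subgraph induced by \<open>P\<close>. It is used for
  the occupied vertices as well as for all vertices.\<close>

definition boundary :: "('a, 'b) pre_digraph \<Rightarrow> 'a set \<Rightarrow> 'a set \<Rightarrow> 'a set" where
  "boundary G P A = {w \<in> P - A. \<exists>v\<in>A. v \<rightarrow>\<^bsub>G\<^esub> w}"

text \<open>Vertex splitting: the arc from \<open>In v\<close> to \<open>Out v\<close> turns the
  capacity of a vertex into that of an arc.\<close>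

datatype 'a flow_node = Source | In 'a | Out 'a

text \<open>
  The capacity \<open>c v\<close> is the number of paths that may leave \<open>v\<close>: a vertex with at least two pebbles can
  start \<open>\<phi> v div 2\<close> of them, a vertex with a single pebble can pass on one that it receives. All
  other arcs have capacity \<open>t\<close>, more than the flow value, and hence do not cross a minimum cut.
\<close>

lemma (in graph) isolating_cut:
  fixes c :: "'a \<Rightarrow> nat"
  assumes P: "P \<subseteq> verts G" "\<And>v. v \<in> P \<Longrightarrow> 1 \<le> \<phi> v" and x: "x \<in> P"
    and c: "\<And>v. c v = max 1 (\<phi> v div 2)"
    and not_collected: "\<And>\<psi>. descendant G \<phi> \<psi> \<Longrightarrow> \<psi> x < t"
  shows "\<exists>A \<subseteq> P. x \<in> A \<and> (\<forall>v\<in>A. 2 \<le> \<phi> v \<longrightarrow> v = x) \<and> sum c (boundary G P A) + \<phi> x < t"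
proof -
  have finP: "finite P" using P(1) finite_verts finite_subset by blast
  define V where "V = insert Source (In ` P \<union> Out ` P)"
  have finV: "finite V" using finP by (simp add: V_def)
  have sumV: "(\<Sum>b\<in>V. f b) = f Source + (\<Sum>v\<in>P. f (In v)) + (\<Sum>v\<in>P. f (Out v))"
    for f :: "'a flow_node \<Rightarrow> int"
  proof -
    have "(\<Sum>b\<in>V. f b) = f Source + (\<Sum>b\<in>In ` P \<union> Out ` P. f b)"
      unfolding V_def using finP by (subst sum.insert) auto
    also have "(\<Sum>b\<in>In ` P \<union> Out ` P. f b) = (\<Sum>b\<in>In ` P. f b) + (\<Sum>b\<in>Out ` P. f b)"
      using finP by (intro sum.union_disjoint) auto
    finally show ?thesis by (simp add: sum.reindex inj_on_def)
  qed
  \<comment> \<open>The sink is \<open>In x\<close>. The source does not feed \<open>x\<close> and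
    no arc out of \<open>In x\<close> or \<open>Out x\<close> has positive capacity, so what arrives
    at \<open>x\<close> stays there.\<close>
  define cap :: "'a flow_node \<Rightarrow> 'a flow_node \<Rightarrow> nat" where "cap a b = (case a of
      Source \<Rightarrow> (case b of In v \<Rightarrow> if v \<in> P \<and> 2 \<le> \<phi> v \<and> v \<noteq> x then t else 0 | _ \<Rightarrow> 0)
    | In v \<Rightarrow> (case b of Out w \<Rightarrow> if v = w \<and> v \<noteq> x then c v else 0 | _ \<Rightarrow> 0)
    | Out v \<Rightarrow> (case b of In w \<Rightarrow> if v \<rightarrow> w \<and> v \<noteq> x then t else 0 | _ \<Rightarrow> 0))" for a b
  have "Source \<in> V" "In x \<in> V" "Source \<noteq> In x" using x by (auto simp: V_def)
  from max_flow_min_cut[OF finV this, of cap] obtain g R where g: "is_flow V cap Source (In x) g"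
    and R: "R \<subseteq> V" "Source \<in> R" "In x \<notin> R"
    and val: "(\<Sum>b\<in>V. g b (In x)) = (\<Sum>a\<in>R. \<Sum>b\<in>V - R. int (cap a b))"
    by blast
  have nodes: "In v \<in> V" "Out v \<in> V" if "v \<in> P" for v using that by (auto simp: V_def)
  have skew: "g a b = - g b a" and le: "g a b \<le> int (cap a b)" for a b
    using g unfolding is_flow_def by blast+
  have cons: "(\<Sum>b\<in>V. g a b) = 0" if "a \<in> V" "a \<noteq> Source" "a \<noteq> In x" for a
    using g that unfolding is_flow_def by blast
  have zero: "g a b = 0" if "cap a b = 0" "cap b a = 0" for a b
    using le[of a b] le[of b a] skew[of a b] that by simp
  \<comment> \<open>One move per unit of flow from \<open>Out v\<close> to \<open>In w\<close>. The
    case \<open>v = w\<close> is excluded because that net flow is the negative of the flow through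
    \<open>v\<close>.\<close>
  define m :: "'a \<Rightarrow> 'a \<Rightarrow> nat" where
    "m v w = (if v \<in> P \<and> w \<in> P \<and> v \<noteq> w then nat (g (Out v) (In w)) else 0)" for v w
  have m: "int (m v w) = (if v = w then 0 else g (Out v) (In w))" if "v \<in> P" "w \<in> P" for v w
  proof (cases "v = w")
    case False
    then have "g (In w) (Out v) \<le> 0" using le[of "In w" "Out v"] by (simp add: cap_def)
    then show ?thesis using that False skew[of "In w" "Out v"] by (simp add: m_def)
  qed (simp add: m_def)
  let ?out = "\<lambda>v. \<Sum>w\<in>P. m v w" and ?in = "\<lambda>v. \<Sum>w\<in>P. m w v"
  have zeros: "g Source (Out v) = 0" "g (Out v) Source = 0" "g (In v) (In w) = 0"
    "g (Out v) (Out w) = 0" for v w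
    by (rule zero; simp add: cap_def)+
  have out_sum: "(\<Sum>w\<in>P. g (Out v) (In w)) = int (?out v) - g (In v) (Out v)"
    and in_sum: "(\<Sum>w\<in>P. g (Out w) (In v)) = int (?in v) - g (In v) (Out v)" if "v \<in> P" for v
  proof -
    have "(\<Sum>w\<in>P. g (Out v) (In w)) = g (Out v) (In v) + (\<Sum>w\<in>P - {v}. g (Out v) (In w))"
      using finP that by (rule sum.remove)
    also have "(\<Sum>w\<in>P - {v}. g (Out v) (In w)) = (\<Sum>w\<in>P - {v}. int (m v w))"
      using m that by (intro sum.cong) auto
    also have "\<dots> = (\<Sum>w\<in>P. int (m v w))"
      using finP that m[OF that that] by (simp add: sum.remove)
    finally show "(\<Sum>w\<in>P. g (Out v) (In w)) = int (?out v) - g (In v) (Out v)"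
      using skew[of "In v" "Out v"] by simp
    have "(\<Sum>w\<in>P. g (Out w) (In v)) = g (Out v) (In v) + (\<Sum>w\<in>P - {v}. g (Out w) (In v))"
      using finP that by (rule sum.remove)
    also have "(\<Sum>w\<in>P - {v}. g (Out w) (In v)) = (\<Sum>w\<in>P - {v}. int (m w v))"
      using m that by (intro sum.cong) auto
    also have "\<dots> = (\<Sum>w\<in>P. int (m w v))"
      using finP that m[OF that that] by (simp add: sum.remove)
    finally show "(\<Sum>w\<in>P. g (Out w) (In v)) = int (?in v) - g (In v) (Out v)"
      using skew[of "In v" "Out v"] by simp
  qed
  \<comment> \<open>Conservation at \<open>Out v\<close>: the moves leaving \<open>v\<close> are the
    flow through \<open>v\<close>. Conservation at \<open>In v\<close>: the moves entering it are
    that flow less the supply from the source.\<close>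
  have out: "int (?out v) = g (In v) (Out v)" if "v \<in> P" for v
    using cons[OF nodes(2)[OF that]] out_sum[OF that] by (simp add: sumV zeros)
  have inn: "int (?in v) = g (In v) (Out v) - g Source (In v)" if "v \<in> P" "v \<noteq> x" for v
  proof -
    have "(\<Sum>w\<in>P. g (In v) (Out w)) = - (\<Sum>w\<in>P. g (Out w) (In v))"
      unfolding sum_negf[symmetric] by (intro sum.cong refl skew)
    then show ?thesis
      using cons[OF nodes(1)[OF that(1)]] in_sum[OF that(1)] that(2) skew[of "In v" Source]
      by (simp add: sumV zeros)
  qed
  have x0: "g (In x) (Out x) = 0" "g Source (In x) = 0"
    by (rule zero; simp add: cap_def adj_not_same)+
  have val_in: "(\<Sum>b\<in>V. g b (In x)) = int (?in x)"
    using in_sum[OF x] by (simp add: sumV zeros x0)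
  have in_all: "(\<Sum>w\<in>verts G. m w v) = ?in v" and out_all: "(\<Sum>w\<in>verts G. m v w) = ?out v" for v
    by (rule sum.mono_neutral_right; use P(1) in \<open>auto simp: m_def\<close>)+
  have "\<exists>\<psi>. descendant G \<phi> \<psi> \<and>
    \<phi> x + (\<Sum>w\<in>verts G. m w x) \<le> \<psi> x + 2 * (\<Sum>w\<in>verts G. m x w)"
  proof (rule pebbling_by_move_counts)
    show "v \<rightarrow> w" if "0 < m v w" for v w
      using that le[of "Out v" "In w"] by (auto simp: m_def cap_def split: if_splits)
    show "2 * (\<Sum>w\<in>verts G. m v w) \<le> \<phi> v + (\<Sum>w\<in>verts G. m w v)" for v
    proof (cases "v \<in> P \<and> v \<noteq> x")
      case True
      then have o: "?out v \<le> c v" using le[of "In v" "Out v"] out[of v]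
        by (simp add: cap_def del: of_nat_sum)
      show ?thesis
      \<comment> \<open>With two or more pebbles, \<open>v\<close> pays for its at most
        \<open>\<phi> v div 2\<close> moves itself. With one pebble it gets nothing from the source,
        so it sends on at most one pebble and has received as many.\<close>
      proof (cases "2 \<le> \<phi> v")
        case True
        with o show ?thesis by (simp add: in_all out_all c)
      next
        case False
        then have "g Source (In v) = 0" by (intro zero) (simp_all add: cap_def)
        then have "?in v = ?out v" using \<open>v \<in> P \<and> v \<noteq> x\<close> inn[of v] out[of v]
          by (simp del: of_nat_sum)
        moreover have "?out v \<le> 1" "\<phi> v = 1" using o False \<open>v \<in> P \<and> v \<noteq> x\<close> P(2)[of v]
          by (auto simp: c)
        ultimately show ?thesis by (simp add: in_all out_all)
      qed
    next
      case False
      have "?out v = 0"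
      proof (cases "v = x")
        case True
        then show ?thesis using out[OF x] x0 by (simp del: of_nat_sum)
      next
        case False
        with \<open>\<not> (v \<in> P \<and> v \<noteq> x)\<close> show ?thesis by (simp add: m_def)
      qed
      then show ?thesis by (simp add: out_all)
    qed
    show "x \<in> verts G" using x P(1) by blast
  qed
  \<comment> \<open>No move leaves \<open>x\<close>, so the flow value is added to
    \<open>\<phi> x\<close>; this bounds the cut.\<close>
  then have "\<phi> x + ?in x < t"
    using not_collected out[OF x] x0 by (force simp: in_all out_all simp del: of_nat_sum)
  then have small: "(\<Sum>a\<in>R. \<Sum>b\<in>V - R. cap a b) + \<phi> x < t"
  proof -
    have "int (\<Sum>a\<in>R. \<Sum>b\<in>V - R. cap a b) = int (?in x)" using val val_in by simp
    with \<open>\<phi> x + ?in x < t\<close> show ?thesis by linarith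
  qed
  have finR: "finite R" using R(1) finV finite_subset by blast
  have one: "cap a b < t" if "a \<in> R" "b \<in> V - R" for a b
  proof -
    have "cap a b \<le> (\<Sum>b\<in>V - R. cap a b)" using that finV by (intro member_le_sum) auto
    also have "\<dots> \<le> (\<Sum>a\<in>R. \<Sum>b\<in>V - R. cap a b)"
      using that finR by (intro member_le_sum) auto
    finally show ?thesis using small by linarith
  qed
  \<comment> \<open>The sink side of the cut. No arc of capacity \<open>t\<close> crosses, so its
    only possible source is \<open>x\<close>, and each boundary vertex \<open>w\<close> has its arc
    from \<open>In w\<close> to \<open>Out w\<close> cut, at cost \<open>c w\<close>.\<close>
  define A where "A = {v \<in> P. In v \<notin> R}"
  let ?D = "boundary G P A"
  have sources: "v = x" if "v \<in> A" "2 \<le> \<phi> v" for v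
    using one[of Source "In v"] that R(2) by (auto simp: A_def V_def cap_def split: if_splits)
  have D: "w \<in> P" "w \<noteq> x" "In w \<in> R" "Out w \<in> V - R" if w: "w \<in> ?D" for w
  proof -
    show w1: "w \<in> P" "w \<noteq> x" "In w \<in> R" using that x R(3) by (auto simp: boundary_def A_def)
    from w obtain v where v: "v \<in> P" "In v \<in> V - R" "v \<rightarrow> w"
      by (auto simp: boundary_def A_def V_def)
    then have "w \<rightarrow> v" using adj_sym by blast
    then show "Out w \<in> V - R" using one[of "Out w" "In v"] v w1 by (auto simp: cap_def V_def)
  qed
  have "sum c ?D = (\<Sum>w\<in>?D. cap (In w) (Out w))"
    by (rule sum.cong) (use D(2) in \<open>auto simp: cap_def\<close>)
  also have "\<dots> \<le> (\<Sum>w\<in>?D. \<Sum>b\<in>V - R. cap (In w) b)"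
    using D finV by (intro sum_mono member_le_sum) auto
  also have "\<dots> = (\<Sum>a\<in>In ` ?D. \<Sum>b\<in>V - R. cap a b)"
    by (simp add: sum.reindex inj_on_def)
  also have "\<dots> \<le> (\<Sum>a\<in>R. \<Sum>b\<in>V - R. cap a b)"
    using D finR by (intro sum_mono2) auto
  finally have "sum c ?D + \<phi> x < t" using small by linarith
  moreover have "A \<subseteq> P" "x \<in> A" using x R(3) by (auto simp: A_def)
  ultimately show ?thesis using sources by blast
qed

section \<open>Greedy choice of an independent set\<close>

text \<open>Read \<open>S\<close> as a digraph. On \<open>c\<close>-weighted average, predecessors
  weigh as much as successors, so some \<open>x\<close> weighs at most \<open>M\<close> together
  with both. Choose it, delete these vertices and repeat.\<close>

lemma weighted_independent_set:
  fixes c :: "'a \<Rightarrow> nat"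
  assumes "finite B" "\<And>x. x \<in> B \<Longrightarrow> c x + 2 * sum c (S x \<inter> B) \<le> M"
  shows "\<exists>I \<subseteq> B. (\<forall>x\<in>I. \<forall>y\<in>I. x \<noteq> y \<longrightarrow> y \<notin> S x) \<and> sum c B \<le> M * card I"
  using assms
proof (induction B rule: finite_psubset_induct)
  case (psubset B)
  show ?case
  proof (cases "sum c B = 0")
    case True
    then show ?thesis by (intro exI[of _ "{}"]) simp
  next
    case False
    define pre where "pre x = {y \<in> B. x \<in> S y}" for x
    have fin: "finite (pre x)" "finite (S x \<inter> B)" for x
      using psubset.hyps(1) by (auto simp: pre_def)
    have "\<exists>x\<in>B. c x + sum c (S x \<inter> B) + sum c (pre x) \<le> M"
    proof (rule ccontr)
      assume "\<not> ?thesis"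
      then have gt: "M < c x + sum c (S x \<inter> B) + sum c (pre x)" if "x \<in> B" for x
        using that by force
      from False obtain z where z: "z \<in> B" "0 < c z" by (metis gr0I sum.neutral)
      have "(\<Sum>x\<in>B. c x * M) < (\<Sum>x\<in>B. c x * (c x + sum c (S x \<inter> B) + sum c (pre x)))"
      proof (rule sum_strict_mono_ex1[OF psubset.hyps(1)])
        show "\<forall>x\<in>B. c x * M \<le> c x * (c x + sum c (S x \<inter> B) + sum c (pre x))"
          using gt by (simp add: less_imp_le)
        show "\<exists>x\<in>B. c x * M < c x * (c x + sum c (S x \<inter> B) + sum c (pre x))"
          using gt z by (intro bexI[of _ z]) simp_all
      qed
      also have "\<dots> = (\<Sum>x\<in>B. c x * (c x + sum c (S x \<inter> B))) + (\<Sum>x\<in>B. c x * sum c (pre x))"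
        by (simp add: sum.distrib algebra_simps)
      \<comment> \<open>Double counting of pairs with weight \<open>c x * c y\<close> turns
        predecessors into successors; hence the factor 2 in the assumption.\<close>
      also have "(\<Sum>x\<in>B. c x * sum c (pre x)) = (\<Sum>x\<in>B. \<Sum>y\<in>B. c x * (if x \<in> S y then c y else 0))"
        using psubset.hyps(1) by (simp add: pre_def sum.inter_filter sum_distrib_left)
      also have "\<dots> = (\<Sum>y\<in>B. \<Sum>x\<in>B. c x * (if x \<in> S y then c y else 0))"
        by (rule sum.swap)
      also have "\<dots> = (\<Sum>y\<in>B. c y * sum c (S y \<inter> B))"
      proof (rule sum.cong[OF refl])
        fix y
        have "S y \<inter> B = {x \<in> B. x \<in> S y}" by auto
        then have "sum c (S y \<inter> B) = (\<Sum>x\<in>B. if x \<in> S y then c x else 0)"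
          using psubset.hyps(1) by (simp add: sum.inter_filter)
        then show "(\<Sum>x\<in>B. c x * (if x \<in> S y then c y else 0)) = c y * sum c (S y \<inter> B)"
          by (auto simp: sum_distrib_left intro: sum.cong)
      qed
      also have "(\<Sum>x\<in>B. c x * (c x + sum c (S x \<inter> B))) + \<dots> =
          (\<Sum>x\<in>B. c x * (c x + 2 * sum c (S x \<inter> B)))"
        unfolding sum.distrib[symmetric]
        by (rule sum.cong) (simp_all add: distrib_left mult_2 add.assoc)
      also have "\<dots> \<le> (\<Sum>x\<in>B. c x * M)"
        using psubset.prems by (intro sum_mono mult_left_mono) auto
      finally show False by simp
    qed
    then obtain x where x: "x \<in> B" "c x + sum c (S x \<inter> B) + sum c (pre x) \<le> M" by blast
    define N where "N = insert x (S x \<inter> B) \<union> pre x"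
    have NB: "N \<subseteq> B" "x \<in> N" using x(1) by (auto simp: N_def pre_def)
    have "sum c N \<le> sum c (insert x (S x \<inter> B)) + sum c (pre x)"
      unfolding N_def using fin by (subst sum.union_inter[symmetric]) auto
    also have "sum c (insert x (S x \<inter> B)) \<le> c x + sum c (S x \<inter> B)"
      using fin(2)[of x] by (cases "x \<in> S x \<inter> B") (simp_all add: insert_absorb)
    finally have N: "sum c N \<le> M" using x(2) by simp
    have "\<exists>I \<subseteq> B - N. (\<forall>x\<in>I. \<forall>y\<in>I. x \<noteq> y \<longrightarrow> y \<notin> S x) \<and> sum c (B - N) \<le> M * card I"
    proof (rule psubset.IH)
      show "B - N \<subset> B" using NB x(1) by blast
      show "c y + 2 * sum c (S y \<inter> (B - N)) \<le> M" if "y \<in> B - N" for y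
      proof -
        have "sum c (S y \<inter> (B - N)) \<le> sum c (S y \<inter> B)"
          using fin(2) by (intro sum_mono2) auto
        with psubset.prems[of y] that show ?thesis by simp
      qed
    qed
    then obtain I where I: "I \<subseteq> B - N" "\<And>x y. x \<in> I \<Longrightarrow> y \<in> I \<Longrightarrow> x \<noteq> y \<Longrightarrow> y \<notin> S x"
      "sum c (B - N) \<le> M * card I" by blast
    have "finite I" using I(1) psubset.hyps(1) finite_subset by blast
    moreover have "x \<notin> I" using I(1) NB by blast
    moreover have "sum c B = sum c (B - N) + sum c N"
      using psubset.hyps(1) NB(1) by (rule sum.subset_diff[rotated])
    ultimately have "sum c B \<le> M * card (insert x I)" using I(3) N by simp
    moreover have "y \<notin> S x" "x \<notin> S y" if "y \<in> I" for y
      using I(1) that by (auto simp: N_def pre_def)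
    then have "\<forall>a\<in>insert x I. \<forall>b\<in>insert x I. a \<noteq> b \<longrightarrow> b \<notin> S a"
      using I(2) by blast
    moreover have "insert x I \<subseteq> B" using I(1) x(1) by blast
    ultimately show ?thesis by blast
  qed
qed

section \<open>Uncrossing\<close>

text \<open>A vertex of \<open>?A'\<close> has no neighbour in \<open>D\<close>. So passing from
  \<open>A\<close> to \<open>?A'\<close> loses the boundary vertices in \<open>D\<close> and gains
  only vertices of \<open>A\<close> on the boundary of \<open>D\<close>.\<close>

lemma (in graph) sum_boundary_Diff:
  fixes c :: "'a \<Rightarrow> nat"
  assumes "finite P" "A \<subseteq> P" "D \<subseteq> P"
  shows "sum c (boundary G P (A - (D \<union> boundary G P D))) + sum c (boundary G P A \<inter> D)
    \<le> sum c (boundary G P A) + sum c (A \<inter> boundary G P D)"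
proof -
  let ?A' = "A - (D \<union> boundary G P D)"
  have fin: "finite (boundary G P X)" for X using assms(1) by (auto simp: boundary_def)
  have "boundary G P ?A' \<subseteq> (boundary G P A - D) \<union> (A \<inter> boundary G P D)"
    using assms(2,3) adj_sym unfolding boundary_def by blast
  then have "sum c (boundary G P ?A') \<le> sum c ((boundary G P A - D) \<union> (A \<inter> boundary G P D))"
    using fin by (intro sum_mono2) auto
  also have "\<dots> \<le> sum c (boundary G P A - D) + sum c (A \<inter> boundary G P D)"
    using fin by (subst sum.union_inter[symmetric]) auto
  finally show ?thesis using sum.Int_Diff[OF fin, of c A D] by linarith
qed

text \<open>Posimodularity: the boundary weight of one of \<open>A - N[D]\<close> and \<open>D - N[A]\<close> does not exceed that
  of the set from which it was cut out.\<close>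

lemma (in graph) minimal_isolating_sets_disjoint:
  fixes c :: "'a \<Rightarrow> nat"
  assumes "finite P" "A \<subseteq> P" "D \<subseteq> P"
    and "x \<in> A" "x \<notin> D" "x \<notin> boundary G P D" "y \<in> D" "y \<notin> A" "y \<notin> boundary G P A"
    and minA: "\<And>A'. A' \<subseteq> A \<Longrightarrow> x \<in> A' \<Longrightarrow> sum c (boundary G P A') \<le> sum c (boundary G P A) \<Longrightarrow> A' = A"
    and minD: "\<And>D'. D' \<subseteq> D \<Longrightarrow> y \<in> D' \<Longrightarrow> sum c (boundary G P D') \<le> sum c (boundary G P D) \<Longrightarrow> D' = D"
  shows "A \<inter> D = {}"
\<comment> \<open>These two sums swap sides when \<open>A\<close> and \<open>D\<close> are
  exchanged, so one of the two sets can be trimmed; by minimality it was disjoint from the other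
  already.\<close>
proof (cases "sum c (A \<inter> boundary G P D) \<le> sum c (boundary G P A \<inter> D)")
  case True
  with sum_boundary_Diff[OF assms(1-3), of c]
  have "A - (D \<union> boundary G P D) = A"
    using assms(4-6) by (intro minA) auto
  then show ?thesis by blast
next
  case False
  have "sum c (boundary G P (D - (A \<union> boundary G P A))) \<le> sum c (boundary G P D)"
    using False sum_boundary_Diff[OF assms(1,3,2), of c] by (simp add: Int_commute)
  then have "D - (A \<union> boundary G P A) = D"
    using assms(7-9) by (intro minD) auto
  then show ?thesis by blast
qed

section \<open>Connectivity and boundaries\<close>

lemma (in graph) vertex_connectivity_le_card_boundary:
  assumes "T \<subseteq> verts G" "x \<in> T" "r \<in> verts G" "r \<notin> T" "r \<notin> boundary G (verts G) T"
  shows "vertex_connectivity G \<le> card (boundary G (verts G) T)"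
proof -
  let ?X = "boundary G (verts G) T"
  \<comment> \<open>\<open>connected\<close> means strong connectivity of this symmetrised graph.
    Its arcs cannot leave \<open>T\<close>, as the neighbours outside \<open>T\<close> are removed,
    so \<open>x\<close> and \<open>r\<close> are separated.\<close>
  let ?H = "with_proj (mk_symmetric (G \<restriction> (verts G - ?X)))"
  have stay: "b \<in> T" if "(a, b) \<in> rtrancl_on (verts ?H) (arcs_ends ?H)" "a \<in> T" for a b
    using that
  proof (induction rule: rtrancl_on_induct)
    case (step b b')
    then have "b \<rightarrow> b'" "b' \<in> verts G - ?X"
      using adj_sym by (auto simp: mk_symmetric_def arcs_ends_def arc_to_ends_def)
    with step show ?case by (auto simp: boundary_def)
  qed simp
  have "\<not> Digraph_Component.connected (G \<restriction> (verts G - ?X))"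
  proof
    assume "Digraph_Component.connected (G \<restriction> (verts G - ?X))"
    then have "x \<rightarrow>\<^sup>*\<^bsub>?H\<^esub> r"
      using assms by (auto simp: Digraph_Component.connected_def strongly_connected_def
          mk_symmetric_def boundary_def)
    then show False using stay[of x r] assms by (simp add: reachable_def)
  qed
  moreover have "?X \<subseteq> verts G" by (auto simp: boundary_def)
  ultimately show ?thesis unfolding vertex_connectivity_def by (intro Least_le) blast
qed

section \<open>Upper bound on the pebbling number\<close>

lemma (in graph) potential_to_pebble_if_highly_connected:
  assumes diam: "diameter G \<le> ereal (real d)"
    and conn: "2 ^ (2 * d + 3) \<le> vertex_connectivity G"
    and size: "pebbling_size G \<phi> = card (verts G)" and r: "r \<in> verts G"
  shows "potential_to_pebble G \<phi> r"
proof (rule ccontr)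
  assume no: "\<not> potential_to_pebble G \<phi> r"
  define t :: nat where "t = 2 ^ d"
  have t: "1 \<le> t" by (simp add: t_def)
  have k: "8 * t * t \<le> vertex_connectivity G"
    using conn by (simp add: t_def power_add power_mult power2_eq_square power_mult_distrib mult.commute)
  have not_collected: "\<psi> u < t" if "u \<in> verts G" "descendant G \<phi> \<psi>" for u \<psi>
    using potential_to_pebble_if_collected[OF diam that(1) r that(2)] no
    unfolding t_def by (meson not_le)
  have not_reached: "\<psi> r = 0" if "descendant G \<phi> \<psi>" for \<psi>
    using no that unfolding potential_to_pebble_def by (meson neq0_conv)
  define P where "P = {v \<in> verts G. 1 \<le> \<phi> v}"
  define U where "U = {v \<in> verts G. \<phi> v = 0}"
  define B where "B = {v \<in> P. 2 \<le> \<phi> v}"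
  define c where "c v = max 1 (\<phi> v div 2)" for v
  have fin: "finite P" "finite U" "finite B" by (auto simp: P_def U_def B_def)
  have rU: "r \<in> U" using r not_reached[OF descendant_refl] by (simp add: U_def)
  have VPU: "verts G = P \<union> U" "P \<inter> U = {}" by (auto simp: P_def U_def)
  let ?b = "boundary G P"
  let ?iso = "\<lambda>x A. A \<subseteq> P \<and> x \<in> A \<and> (\<forall>v\<in>A. 2 \<le> \<phi> v \<longrightarrow> v = x) \<and> sum c (?b A) + \<phi> x < t"
  have "\<exists>A. ?iso x A \<and> (\<forall>A'. ?iso x A' \<longrightarrow> card A \<le> card A')" if "x \<in> B" for x
  proof -
    have "\<exists>A \<subseteq> P. x \<in> A \<and> (\<forall>v\<in>A. 2 \<le> \<phi> v \<longrightarrow> v = x) \<and> sum c (?b A) + \<phi> x < t"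
      by (rule isolating_cut) (use that not_collected in \<open>auto simp: P_def B_def c_def\<close>)
    then obtain A0 where "?iso x A0" by blast
    from ex_has_least_nat[of "?iso x", OF this, of card] show ?thesis by blast
  qed
  then obtain A where A: "\<And>x. x \<in> B \<Longrightarrow> ?iso x (A x)"
    and A_min: "\<And>x A'. x \<in> B \<Longrightarrow> ?iso x A' \<Longrightarrow> card (A x) \<le> card A'"
    by metis
  \<comment> \<open>Subsets of \<open>A x\<close> containing \<open>x\<close> inherit the other
    conditions, so minimal size gives the inclusion-minimality needed for uncrossing.\<close>
  have A_min: "A' = A x" if "x \<in> B" "A' \<subseteq> A x" "x \<in> A'" "sum c (?b A') \<le> sum c (?b (A x))" for x A'
  proof -
    have "?iso x A'" using A[OF that(1)] that(2-4) by force
    then have "card (A x) \<le> card A'" by (rule A_min[OF that(1)])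
    moreover have "finite (A x)" using A[OF that(1)] fin(1) finite_subset by blast
    ultimately show ?thesis using that(2) by (intro card_seteq)
  qed
  have "\<exists>I \<subseteq> B. (\<forall>x\<in>I. \<forall>y\<in>I. x \<noteq> y \<longrightarrow> y \<notin> ?b (A x)) \<and> sum c B \<le> (2 * t) * card I"
  proof (rule weighted_independent_set[OF fin(3)])
    fix x assume x: "x \<in> B"
    have "sum c (?b (A x) \<inter> B) \<le> sum c (?b (A x))"
      using fin(1) by (intro sum_mono2) (auto simp: boundary_def)
    moreover have "c x \<le> \<phi> x" using x by (auto simp: c_def B_def)
    \<comment> \<open>Here \<open>c x \<le> \<phi> x\<close>, and twice
      \<open>sum c (?b (A x)) + \<phi> x < t\<close> gives the bound \<open>2 * t\<close>.\<close>
    ultimately show "c x + 2 * sum c (?b (A x) \<inter> B) \<le> 2 * t" using A[OF x] by linarith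
  qed
  then obtain I where I: "I \<subseteq> B" "\<And>x y. x \<in> I \<Longrightarrow> y \<in> I \<Longrightarrow> x \<noteq> y \<Longrightarrow> y \<notin> ?b (A x)"
    "sum c B \<le> 2 * t * card I" by blast
  have finI: "finite I" using I(1) fin(3) finite_subset by blast
  have disj: "A x \<inter> A y = {}" if "x \<in> I" "y \<in> I" "x \<noteq> y" for x y
  proof -
    have B: "x \<in> B" "y \<in> B" using that I(1) by auto
    have sep: "x \<notin> A y" "y \<notin> A x" using A[OF B(1)] A[OF B(2)] B that(3) by (auto simp: B_def)
    show ?thesis
    proof (rule minimal_isolating_sets_disjoint[OF fin(1)])
      show "A x \<subseteq> P" "x \<in> A x" "A y \<subseteq> P" "y \<in> A y" using A[OF B(1)] A[OF B(2)] by blast+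
      show "x \<notin> ?b (A y)" "y \<notin> ?b (A x)" using I(2) that by blast+
    qed (fact sep A_min[OF B(1)] A_min[OF B(2)])+
  qed
  \<comment> \<open>The component of \<open>x\<close> in \<open>A x\<close>: only from there can a
    pebble of \<open>x\<close> be sent along vertices of \<open>A x\<close>.\<close>
  define T where "T x = {v. (\<lambda>a b. a \<rightarrow> b \<and> b \<in> A x)\<^sup>*\<^sup>* x v}" for x
  have T_self: "x \<in> T x" for x by (simp add: T_def)
  have T_sub: "T x \<subseteq> A x" if "x \<in> B" for x
  proof
    fix v assume "v \<in> T x"
    then have "(\<lambda>a b. a \<rightarrow> b \<and> b \<in> A x)\<^sup>*\<^sup>* x v" by (simp add: T_def)
    then show "v \<in> A x" by (induction rule: rtranclp_induct) (use A[OF that] in auto)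
  qed
  have T_step: "w \<in> T x" if "v \<in> T x" "v \<rightarrow> w" "w \<in> A x" for v w x
    using that unfolding T_def by (auto intro: rtranclp.rtrancl_into_rtrancl)
  have T_conn: "(\<lambda>a b. a \<rightarrow> b \<and> b \<in> T x)\<^sup>*\<^sup>* x v" if "v \<in> T x" for v x
  proof -
    from that have "(\<lambda>a b. a \<rightarrow> b \<and> b \<in> A x)\<^sup>*\<^sup>* x v" by (simp add: T_def)
    then show ?thesis
    proof (induction rule: rtranclp_induct)
      case (step v w)
      then have "w \<in> T x" by (auto simp: T_def intro: rtranclp.rtrancl_into_rtrancl)
      with step show ?case by (auto intro: rtranclp.rtrancl_into_rtrancl)
    qed simp
  qed
  let ?J = "\<lambda>u. {x \<in> I. \<exists>v\<in>T x. v \<rightarrow> u}"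
  have collect: "\<exists>\<psi>. descendant G \<phi> \<psi> \<and> \<psi> u = card (?J u)" if u: "u \<in> U" for u
  proof -
    have "\<exists>\<psi>. descendant G \<phi> \<psi> \<and> \<psi> u = \<phi> u + card (?J u) \<and>
        (\<forall>v. v \<notin> insert u (\<Union>x\<in>?J u. T x) \<longrightarrow> \<psi> v = \<phi> v)"
    proof (rule pebbles_collected_from_territories)
      fix x assume "x \<in> ?J u"
      then have x: "x \<in> I" "x \<in> B" "\<exists>v\<in>T x. v \<rightarrow> u" using I(1) by auto
      show "2 \<le> \<phi> x" using x(2) by (simp add: B_def)
      have "T x \<subseteq> P" using T_sub[OF x(2)] A[OF x(2)] by blast
      then show "1 \<le> \<phi> v" if "v \<in> T x" for v using that by (auto simp: P_def)
      show "x \<in> T x \<and> u \<notin> T x" using T_self \<open>T x \<subseteq> P\<close> u VPU(2) by blast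
      show "\<exists>v. (\<lambda>a b. a \<rightarrow> b \<and> b \<in> T x)\<^sup>*\<^sup>* x v \<and> v \<rightarrow> u" using x(3) T_conn by blast
      show "T x \<inter> T y = {}" if "y \<in> ?J u" "x \<noteq> y" for y
        using disj[of x y] T_sub[OF x(2)] T_sub[of y] x(1) that I(1) by blast
    qed (use finI in simp)
    then show ?thesis using u by (auto simp: U_def)
  qed
  have J_lt: "card (?J u) < t" if u: "u \<in> U" for u
    using collect[OF u] not_collected[of u] u by (force simp: U_def)
  have J_r: "?J r = {}"
    using collect[OF rU] not_reached finI by force
  have U_nbrs: "8 * t * t \<le> t + card (U \<inter> {u. \<exists>v\<in>T x. v \<rightarrow> u})" if xI: "x \<in> I" for x
  proof -
    have x: "x \<in> B" using xI I(1) by blast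
    have TP: "T x \<subseteq> P" using T_sub[OF x] A[OF x] by blast
    have "8 * t * t \<le> card (boundary G (verts G) (T x))"
    proof (rule order_trans[OF k vertex_connectivity_le_card_boundary])
      show "T x \<subseteq> verts G" using TP VPU(1) by blast
      show "r \<notin> T x" using TP rU VPU(2) by blast
      show "r \<notin> boundary G (verts G) (T x)" using J_r xI by (auto simp: boundary_def)
    qed (use T_self r in auto)
    \<comment> \<open>Neighbours of \<open>T x\<close> in \<open>A x\<close> are in
      \<open>T x\<close>, so the occupied ones left lie in the boundary of \<open>A x\<close>. Since
      \<open>c\<close> is at least 1, there are fewer than \<open>t\<close> of these.\<close>
    also have "boundary G (verts G) (T x) \<subseteq> ?b (A x) \<union> (U \<inter> {u. \<exists>v\<in>T x. v \<rightarrow> u})"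
      using T_step T_sub[OF x] unfolding boundary_def VPU(1) by blast
    then have "card (boundary G (verts G) (T x))
        \<le> card (?b (A x) \<union> (U \<inter> {u. \<exists>v\<in>T x. v \<rightarrow> u}))"
      using fin by (intro card_mono) (auto simp: boundary_def)
    also have "\<dots> \<le> card (?b (A x)) + card (U \<inter> {u. \<exists>v\<in>T x. v \<rightarrow> u})" by (rule card_Un_le)
    also have "card (?b (A x)) \<le> sum c (?b (A x))"
      using sum_mono[of "?b (A x)" "\<lambda>_. 1" c] by (simp add: c_def)
    also have "sum c (?b (A x)) \<le> t" using A[OF x] by simp
    finally show ?thesis by simp
  qed
  have "(\<Sum>x\<in>I. card (U \<inter> {u. \<exists>v\<in>T x. v \<rightarrow> u})) = (\<Sum>x\<in>I. \<Sum>u\<in>U. of_bool (\<exists>v\<in>T x. v \<rightarrow> u))"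
    using fin(2) by simp
  also have "\<dots> = (\<Sum>u\<in>U. \<Sum>x\<in>I. of_bool (\<exists>v\<in>T x. v \<rightarrow> u))" by (rule sum.swap)
  also have "\<dots> = (\<Sum>u\<in>U. card (?J u))"
    using finI by (simp add: Int_def)
  also have "\<dots> \<le> (\<Sum>u\<in>U. t)" using J_lt by (intro sum_mono) (simp add: less_imp_le)
  finally have edges: "(\<Sum>x\<in>I. card (U \<inter> {u. \<exists>v\<in>T x. v \<rightarrow> u})) \<le> card U * t" by simp
  have "card P + card U = (\<Sum>v\<in>P. \<phi> v) + (\<Sum>v\<in>U. \<phi> v)"
    using size fin VPU by (simp add: pebbling_size_def card_Un_disjoint sum.union_disjoint)
  also have "(\<Sum>v\<in>U. \<phi> v) = 0" by (simp add: U_def)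
  \<comment> \<open>Halving loses at most one pebble per vertex. As the size is the number of
    vertices, the empty ones are compensated by the surplus on \<open>B\<close>.\<close>
  also have "(\<Sum>v\<in>P. \<phi> v) \<le> (\<Sum>v\<in>P. 1 + 2 * (if 2 \<le> \<phi> v then c v else 0))"
    by (intro sum_mono) (auto simp: c_def)
  also have "\<dots> = card P + 2 * sum c B"
    unfolding sum.distrib using fin(1) by (simp add: B_def sum.inter_filter sum_distrib_left)
  finally have U: "card U \<le> 2 * sum c B" by simp
  have "card I * (8 * t * t) \<le> (\<Sum>x\<in>I. t + card (U \<inter> {u. \<exists>v\<in>T x. v \<rightarrow> u}))"
    using sum_mono[OF U_nbrs, of I "\<lambda>x. x"] by simp
  also have "\<dots> \<le> card I * t + card U * t" using edges by (simp add: sum.distrib)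
  also have "\<dots> \<le> card I * t + (2 * (2 * t * card I)) * t"
    using U I(3) by (intro add_left_mono mult_right_mono) auto
  finally have "card I * (8 * t * t) \<le> card I * (t + 4 * t * t)" by (simp add: algebra_simps)
  \<comment> \<open>Since \<open>r\<close> is empty, \<open>U\<close> and hence \<open>I\<close> are
    nonempty; cancelling \<open>card I\<close> leaves \<open>4 * t * t \<le> t\<close>, which is
    absurd.\<close>
  moreover have "0 < card I"
  proof -
    have "0 < card U" using rU fin(2) by (auto simp: card_gt_0_iff)
    then show ?thesis using U I(3) by (cases "card I = 0") auto
  qed
  ultimately have "8 * t * t \<le> t + 4 * t * t" by simp
  moreover have "t \<le> t * t" using t by simp
  ultimately show False using t by linarith
qed

section \<open>Lower bound on the pebbling number\<close>

text \<open>With at most one pebble on each vertex no move is possible.\<close>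

lemma not_potential_to_pebble_singletons:
  assumes "x \<notin> S"
  shows "\<not> potential_to_pebble G (\<lambda>v. of_bool (v \<in> S)) x"
proof -
  have "\<psi> = (\<lambda>v. of_bool (v \<in> S))" if "descendant G (\<lambda>v. of_bool (v \<in> S)) \<psi>" for \<psi>
    using that unfolding descendant_def
    by (induction rule: rtranclp_induct) (auto elim!: pebbling_move.cases simp: of_bool_def split: if_splits)
  then show ?thesis using assms unfolding potential_to_pebble_def by force
qed

text \<open>Fewer than \<open>card (verts G)\<close> pebbles can be placed singly so that some
  \<open>x\<close> stays empty.\<close>

lemma (in graph) card_verts_le_if_all_pebblable:
  assumes "\<And>\<phi> x. pebbling_size G \<phi> = p \<Longrightarrow> x \<in> verts G \<Longrightarrow> potential_to_pebble G \<phi> x"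
  shows "card (verts G) \<le> p"
proof (rule ccontr)
  assume "\<not> ?thesis"
  then have p: "p < card (verts G)" by simp
  then obtain x where x: "x \<in> verts G" by fastforce
  with p have "p \<le> card (verts G - {x})" by simp
  then obtain S where S: "S \<subseteq> verts G - {x}" "card S = p" by (rule obtain_subset_with_card_n)
  have "pebbling_size G (\<lambda>v. of_bool (v \<in> S)) = card (verts G \<inter> S)"
    by (simp add: pebbling_size_def)
  also have "verts G \<inter> S = S" using S(1) by blast
  finally show False
    using assms[of "\<lambda>v. of_bool (v \<in> S)", OF _ x] S not_potential_to_pebble_singletons[of x S] by auto
qed

theorem theorem2p1:
  fixes G :: "('a, 'b) pre_digraph" and d k :: nat
  assumes "d > 0"
    and "k = 2 ^ (2 * d + 3)"
    and "graph G"
    and "diameter G \<le> ereal (real d)"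
    and "vertex_connectivity G \<ge> k"
  shows "pebbling_number G = card (verts G)"
proof -
  interpret graph G by fact
  show ?thesis
    unfolding pebbling_number_def
  proof (rule Least_equality)
    show "\<forall>\<phi>. pebbling_size G \<phi> = card (verts G) \<longrightarrow> (\<forall>x\<in>verts G. potential_to_pebble G \<phi> x)"
      using potential_to_pebble_if_highly_connected[OF assms(4)] assms(2,5) by blast
  qed (use card_verts_le_if_all_pebblable in blast)
qed

end
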